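(* Let $G$ be a finite simple graph with at least two vertices. The family $\mathcal{F}(G)$ of all induced $G$-free graphs is feasible if and only if $G$ is not isomorphic to any of the graphs $K_k$, $K_k\backslash K_2$, $\overline{K_k}$, $\overline{K_k\backslash K_2}$ with $k\geq 2$.
   Context: All graphs are finite and simple. A family $\mathcal{F}$ of graphs is called feasible if for every pair of integers $(n,m)$ with $n\geq 1$ and $0\leq m\leq\binom{n}{2}$ there is a graph in $\mathcal{F}$ having exactly $n$ vertices and exactly $m$ edges. A graph is induced $G$-free if it has no induced subgraph isomorphic to $G$; $\mathcal{F}(G)$ denotes the family of all induced $G$-free graphs. $K_k$ is the complete graph on $k$ vertices, $K_k\backslash K_2$ is the graph obtained from $K_k$ by deleting one edge (keeping all $k$ vertices), and $\overline{X}$ denotes the complement of the graph $X$. *)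

theory Defs
  imports "HOL-Library.Ramsey"
begin

text \<open>The edges of a graph are 2-element subsets of its vertex set; \<open>[V]\<^bsup>2\<^esup>\<close> is
  the set of all of them.\<close>

record 'a sgraph =
  verts :: "'a set"
  edges :: "'a set set"

definition simple_graph :: "'a sgraph \<Rightarrow> bool" where
  "simple_graph G \<longleftrightarrow> finite (verts G) \<and> edges G \<subseteq> [verts G]\<^bsup>2\<^esup>"

definition graph_iso :: "'a sgraph \<Rightarrow> 'b sgraph \<Rightarrow> bool"  (infix \<open>\<simeq>\<^sub>g\<close> 50) where
  "G \<simeq>\<^sub>g H \<longleftrightarrow> (\<exists>f. bij_betw f (verts G) (verts H) \<and>
     (\<forall>u\<in>verts G. \<forall>v\<in>verts G. {u, v} \<in> edges G \<longleftrightarrow> {f u, f v} \<in> edges H))"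

definition induced :: "'a sgraph \<Rightarrow> 'a set \<Rightarrow> 'a sgraph" where
  "induced G S = \<lparr>verts = S, edges = edges G \<inter> [S]\<^bsup>2\<^esup>\<rparr>"

definition induced_free :: "'a sgraph \<Rightarrow> 'b sgraph \<Rightarrow> bool" where
  "induced_free G H \<longleftrightarrow> \<not> (\<exists>S\<subseteq>verts H. induced H S \<simeq>\<^sub>g G)"

text \<open>Being induced \<open>G\<close>-free, the number of vertices and the number of edges are invariant
  under isomorphism, so it suffices to let the family range over graphs on finite sets of natural
  numbers; see \<open>ex_iso_nat_graph\<close> below. The vertex type of \<open>G\<close> is arbitrary.\<close>

definition induced_free_family :: "'a sgraph \<Rightarrow> nat sgraph set" where
  "induced_free_family G = {H. simple_graph H \<and> induced_free G H}"

definition feasible :: "'a sgraph set \<Rightarrow> bool" where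
  "feasible F \<longleftrightarrow> (\<forall>n m. 1 \<le> n \<and> m \<le> n choose 2 \<longrightarrow>
     (\<exists>H\<in>F. card (verts H) = n \<and> card (edges H) = m))"

definition complement :: "'a sgraph \<Rightarrow> 'a sgraph" where
  "complement G = \<lparr>verts = verts G, edges = [verts G]\<^bsup>2\<^esup> - edges G\<rparr>"

definition complete_graph :: "nat \<Rightarrow> nat sgraph" where
  "complete_graph k = \<lparr>verts = {..<k}, edges = [{..<k}]\<^bsup>2\<^esup>\<rparr>"

definition delete_edge :: "'a sgraph \<Rightarrow> 'a set \<Rightarrow> 'a sgraph" where
  "delete_edge G e = \<lparr>verts = verts G, edges = edges G - {e}\<rparr>"

text \<open>All edges of a complete graph are equivalent under its automorphisms. The deleted edge
  \<open>{0, 1}\<close> is present only if \<open>k \<ge> 2\<close>.\<close>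

definition complete_minus_edge :: "nat \<Rightarrow> nat sgraph" where
  "complete_minus_edge k = delete_edge (complete_graph k) {0, 1}"

lemma ex_iso_nat_graph:
  fixes G :: "'a sgraph"
  assumes "simple_graph G"
  shows "\<exists>H :: nat sgraph. simple_graph H \<and> G \<simeq>\<^sub>g H"
proof -
  have fin: "finite (verts G)" and E: "edges G \<subseteq> [verts G]\<^bsup>2\<^esup>"
    using assms by (auto simp: simple_graph_def)
  obtain f :: "'a \<Rightarrow> nat" where inj: "inj_on f (verts G)"
    using finite_imp_inj_to_nat_seg[OF fin] by blast
  define H where "H = \<lparr>verts = f ` verts G, edges = (`) f ` edges G\<rparr>"
  have sub: "e \<subseteq> verts G" "finite e" "card e = 2" if "e \<in> edges G" for e
    using E that by (auto simp: nsets_def)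
  have simple: "simple_graph H"
  proof -
    have "f ` e \<in> [f ` verts G]\<^bsup>2\<^esup>" if "e \<in> edges G" for e
      using sub[OF that] card_image[OF inj_on_subset[OF inj sub(1)[OF that]]]
      by (simp add: nsets_def image_mono)
    then have "edges H \<subseteq> [verts H]\<^bsup>2\<^esup>"
      unfolding H_def by (simp add: image_subset_iff)
    moreover have "finite (verts H)"
      using fin by (simp add: H_def)
    ultimately show ?thesis
      by (simp add: simple_graph_def)
  qed
  have adj: "{u, v} \<in> edges G \<longleftrightarrow> {f u, f v} \<in> edges H"
    if uv: "u \<in> verts G" "v \<in> verts G" for u v
  proof
    assume "{u, v} \<in> edges G"
    then have "f ` {u, v} \<in> edges H"
      unfolding H_def sgraph.simps by (rule imageI)
    then show "{f u, f v} \<in> edges H"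
      by simp
  next
    assume "{f u, f v} \<in> edges H"
    then have "f ` {u, v} \<in> (`) f ` edges G"
      by (simp add: H_def)
    then obtain e where e: "e \<in> edges G" "f ` {u, v} = f ` e"
      by (rule imageE)
    have "{u, v} = e"
      using inj_on_image_eq_iff[OF inj _ sub(1)[OF e(1)], of "{u, v}"] uv e(2) by blast
    then show "{u, v} \<in> edges G"
      using e(1) by (rule ssubst)
  qed
  have bij: "bij_betw f (verts G) (verts H)"
    using inj by (simp add: bij_betw_def H_def)
  show ?thesis
    using simple bij adj unfolding graph_iso_def by blast
qed

end

(* Every pair (n, m) is realised by K_p minus a star plus n - p isolated vertices: take the least p
   with m \<le> p choose 2, so that M = (p choose 2) - m edges have to be removed, where M = 0 or
   M + 2 \<le> p. If both G and its complement are induced subgraphs of such graphs, then G has at most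
   one edge, or at most one non-edge, or G or its complement contains an induced paw (a triangle
   with a pendant edge). F(G) is feasible iff F of the complement of G is, so only a G with an
   induced paw remains. Then one removes from K_p disjoint triangles and edges instead of a star: in
   the resulting graph non-adjacency of non-isolated vertices is transitive, so it has no induced
   paw. Conversely, a graph with at most one edge is determined by its numbers of vertices and
   edges. *)

theory Submission
  imports Defs
begin

section \<open>Isomorphisms and complements\<close>

lemma graph_iso_sym:
  assumes "G \<simeq>\<^sub>g H" shows "H \<simeq>\<^sub>g G"
proof -
  obtain f where f: "bij_betw f (verts G) (verts H)"
    and e: "\<forall>u\<in>verts G. \<forall>v\<in>verts G. {u, v} \<in> edges G \<longleftrightarrow> {f u, f v} \<in> edges H"
    using assms unfolding graph_iso_def by blast
  let ?g = "inv_into (verts G) f"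
  have g: "bij_betw ?g (verts H) (verts G)"
    using f by (rule bij_betw_inv_into)
  have "{u, v} \<in> edges H \<longleftrightarrow> {?g u, ?g v} \<in> edges G" if "u \<in> verts H" "v \<in> verts H" for u v
    using e bij_betwE[OF g] bij_betw_inv_into_right[OF f] that by simp
  then show ?thesis
    using g unfolding graph_iso_def by blast
qed

lemma graph_iso_complement:
  assumes "G \<simeq>\<^sub>g H" shows "complement G \<simeq>\<^sub>g complement H"
proof -
  obtain f where f: "bij_betw f (verts G) (verts H)"
    and e: "\<forall>u\<in>verts G. \<forall>v\<in>verts G. {u, v} \<in> edges G \<longleftrightarrow> {f u, f v} \<in> edges H"
    using assms unfolding graph_iso_def by blast
  have "{u, v} \<in> edges (complement G) \<longleftrightarrow> {f u, f v} \<in> edges (complement H)"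
    if "u \<in> verts G" "v \<in> verts G" for u v
    using e that bij_betwE[OF f] bij_betw_imp_inj_on[OF f]
    by (auto simp: complement_def inj_on_eq_iff)
  then show ?thesis
    using f unfolding graph_iso_def by (auto simp: complement_def)
qed

lemma simple_graph_finite_edges:
  assumes "simple_graph G" shows "finite (edges G)"
  using assms by (meson finite_subset finite_imp_finite_nsets simple_graph_def)

lemma simple_graph_edgeE:
  assumes "simple_graph G" "e \<in> edges G"
  obtains u v where "e = {u, v}" "u \<in> verts G" "v \<in> verts G" "u \<noteq> v"
  using assms that unfolding simple_graph_def by (blast elim: nsets2_E)

lemma graph_iso_card_edges:
  assumes "simple_graph G" "simple_graph H" "G \<simeq>\<^sub>g H"
  shows "card (edges G) = card (edges H)"
proof -
  obtain f where f: "bij_betw f (verts G) (verts H)"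
    and e: "\<forall>u\<in>verts G. \<forall>v\<in>verts G. {u, v} \<in> edges G \<longleftrightarrow> {f u, f v} \<in> edges H"
    using assms unfolding graph_iso_def by blast
  have "inj_on ((`) f) (edges G)"
  proof (rule inj_on_subset[OF inj_on_image_Pow])
    show "inj_on f (verts G)"
      using f by (rule bij_betw_imp_inj_on)
    show "edges G \<subseteq> Pow (verts G)"
      using assms(1) by (auto simp: simple_graph_def nsets_def)
  qed
  moreover have "(`) f ` edges G = edges H"
  proof (intro equalityI subsetI)
    fix d assume "d \<in> (`) f ` edges G"
    then obtain c where c: "c \<in> edges G" "d = f ` c" by blast
    obtain u v where "c = {u, v}" "u \<in> verts G" "v \<in> verts G"
      using simple_graph_edgeE[OF assms(1) c(1)] by blast
    then show "d \<in> edges H"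
      using e c by auto
  next
    fix d assume d: "d \<in> edges H"
    then obtain x y where xy: "d = {x, y}" "x \<in> verts H" "y \<in> verts H"
      using simple_graph_edgeE[OF assms(2)] by blast
    then obtain u v where uv: "u \<in> verts G" "v \<in> verts G" "x = f u" "y = f v"
      using f unfolding bij_betw_def by blast
    then have "{u, v} \<in> edges G" "d = f ` {u, v}"
      using e d xy by auto
    then show "d \<in> (`) f ` edges G" by blast
  qed
  ultimately show ?thesis
    using card_image by fastforce
qed

lemma simple_graph_complement: "simple_graph G \<Longrightarrow> simple_graph (complement G)"
  by (auto simp: simple_graph_def complement_def)

lemma complement_complement: "simple_graph G \<Longrightarrow> complement (complement G) = G"
  by (simp add: simple_graph_def complement_def double_diff)

lemma verts_complement [simp]: "verts (complement G) = verts G"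
  by (simp add: complement_def)

lemma card_edges_complement:
  assumes "simple_graph G"
  shows "card (edges (complement G)) = (card (verts G) choose 2) - card (edges G)"
  using assms simple_graph_finite_edges[OF assms]
  by (simp add: complement_def simple_graph_def card_Diff_subset card_nsets)

lemma card_edges_le:
  assumes "simple_graph G"
  shows "card (edges G) \<le> card (verts G) choose 2"
  using assms card_mono[of "[verts G]\<^bsup>2\<^esup>" "edges G"] finite_imp_finite_nsets[of "verts G" 2]
  by (simp add: simple_graph_def card_nsets)

lemma induced_complement:
  assumes "S \<subseteq> verts H"
  shows "induced (complement H) S = complement (induced H S)"
  using assms by (auto simp: induced_def complement_def nsets_def)

lemma simple_graph_induced:
  assumes "simple_graph H" "S \<subseteq> verts H" shows "simple_graph (induced H S)"
  using assms finite_subset by (auto simp: simple_graph_def induced_def)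

text \<open>Complementation commutes with taking induced subgraphs, so a copy of G in the complement
  of H sits on the same vertices as a copy of the complement of G in H.\<close>

lemma induced_free_complement:
  assumes "simple_graph G" "simple_graph H" "induced_free (complement G) H"
  shows "induced_free G (complement H)"
  unfolding induced_free_def
proof (intro notI, elim exE conjE)
  fix S assume S: "S \<subseteq> verts (complement H)" and iso: "induced (complement H) S \<simeq>\<^sub>g G"
  have "induced H S = complement (induced (complement H) S)"
    using S induced_complement[of S H] simple_graph_induced[OF assms(2)]
    by (simp add: complement_complement)
  also have "\<dots> \<simeq>\<^sub>g complement G"
    using iso by (rule graph_iso_complement)
  finally show False
    using assms(3) S by (auto simp: induced_free_def)
qed

text \<open>Complementation turns m edges on n vertices into \<open>(n choose 2) - m\<close>, so it
  permutes the admissible pairs with a given n. Applied to G and to its complement, this makes the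
  two feasibility statements equivalent.\<close>

lemma feasible_complementD:
  assumes "simple_graph G" "feasible (induced_free_family (complement G))"
  shows "feasible (induced_free_family G)"
  unfolding feasible_def
proof (intro allI impI, elim conjE)
  fix n m :: nat assume nm: "1 \<le> n" "m \<le> n choose 2"
  then obtain H where H: "H \<in> induced_free_family (complement G)"
    "card (verts H) = n" "card (edges H) = (n choose 2) - m"
    using assms(2) unfolding feasible_def by (meson diff_le_self)
  then have simp: "simple_graph H"
    by (simp add: induced_free_family_def)
  have "complement H \<in> induced_free_family G"
    using H simp assms(1) induced_free_complement
    by (auto simp: induced_free_family_def simple_graph_complement)
  moreover have "card (verts (complement H)) = n" "card (edges (complement H)) = m"
    using H nm simp by (auto simp: card_edges_complement)
  ultimately show "\<exists>H\<in>induced_free_family G. card (verts H) = n \<and> card (edges H) = m"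
    by blast
qed

section \<open>Graphs with at most one edge\<close>

text \<open>Serves to match the only edges of two one-edge graphs; the remaining points are paired
  arbitrarily.\<close>

lemma ex_bij_betw_pair:
  assumes "finite A" "finite B" "card A = card B" "a \<in> A" "b \<in> A" "a \<noteq> b" "c \<in> B" "d \<in> B" "c \<noteq> d"
  obtains f where "bij_betw f A B" "f a = c" "f b = d"
proof -
  have "card (A - {a, b}) = card (B - {c, d})"
    using assms by (simp add: card_Diff_subset)
  then obtain g where g: "bij_betw g (A - {a, b}) (B - {c, d})"
    using assms by (metis finite_Diff finite_same_card_bij)
  let ?f = "g(a := c, b := d)"
  have "bij_betw ?f (A - {a, b}) (B - {c, d})"
    using g by (subst bij_betw_cong[of _ _ g]) auto
  moreover have "bij_betw ?f {a, b} {c, d}"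
    using assms by (auto simp: bij_betw_def)
  ultimately have "bij_betw ?f ((A - {a, b}) \<union> {a, b}) ((B - {c, d}) \<union> {c, d})"
    by (rule bij_betw_combine) auto
  moreover have "(A - {a, b}) \<union> {a, b} = A" "(B - {c, d}) \<union> {c, d} = B"
    using assms by auto
  ultimately show thesis
    using that[of ?f] assms by simp
qed

lemma graph_iso_if_card_edges_le_1:
  assumes "simple_graph G" "simple_graph H" "card (verts G) = card (verts H)"
    "card (edges G) = card (edges H)" "card (edges G) \<le> 1"
  shows "G \<simeq>\<^sub>g H"
proof -
  have fin: "finite (verts G)" "finite (verts H)"
    using assms by (auto simp: simple_graph_def)
  consider "card (edges G) = 0" | "card (edges G) = 1"
    using assms by linarith
  then show ?thesis
  proof cases
    case 1
    then have "edges G = {}" "edges H = {}"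
      using assms simple_graph_finite_edges by (metis card_0_eq)+
    moreover obtain f where "bij_betw f (verts G) (verts H)"
      using fin assms finite_same_card_bij by blast
    ultimately show ?thesis
      by (auto simp: graph_iso_def)
  next
    case 2
    obtain d where d: "edges G = {d}"
      using 2 by (auto simp: card_1_singleton_iff)
    obtain c where c: "edges H = {c}"
      using 2 assms by (auto simp: card_1_singleton_iff)
    obtain u v where uv: "d = {u, v}" "u \<in> verts G" "v \<in> verts G" "u \<noteq> v"
      using d simple_graph_edgeE[OF assms(1)] by blast
    obtain x y where xy: "c = {x, y}" "x \<in> verts H" "y \<in> verts H" "x \<noteq> y"
      using c simple_graph_edgeE[OF assms(2)] by blast
    obtain f where f: "bij_betw f (verts G) (verts H)" "f u = x" "f v = y"
      using ex_bij_betw_pair[OF fin assms(3) uv(2-4) xy(2-4)] .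
    have "{s, t} \<in> edges G \<longleftrightarrow> {f s, f t} \<in> edges H" if "s \<in> verts G" "t \<in> verts G" for s t
      using that uv xy f d c inj_on_eq_iff[OF bij_betw_imp_inj_on[OF f(1)]]
      by (auto simp: doubleton_eq_iff)
    then show ?thesis
      using f by (auto simp: graph_iso_def)
  qed
qed

text \<open>The numbers of vertices and edges of G itself form a pair that is not realised: every
  graph with these numbers is isomorphic to G, hence contains G on its full vertex set.\<close>

lemma not_feasible_if_card_edges_le_1:
  assumes "simple_graph G" "card (verts G) \<ge> 1" "card (edges G) \<le> 1"
  shows "\<not> feasible (induced_free_family G)"
proof
  assume "feasible (induced_free_family G)"
  then obtain H where "H \<in> induced_free_family G"
    and card: "card (verts H) = card (verts G)" "card (edges H) = card (edges G)"
    using assms(2) card_edges_le[OF assms(1)] unfolding feasible_def by meson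
  then have H: "simple_graph H" "induced_free G H"
    by (auto simp: induced_free_family_def)
  then have "H \<simeq>\<^sub>g G"
    using assms card by (intro graph_iso_if_card_edges_le_1) auto
  moreover have "induced H (verts H) = H"
    using H by (simp add: induced_def simple_graph_def Int_absorb2)
  ultimately show False
    using H by (metis induced_free_def order_refl)
qed

section \<open>The exceptional graphs, recognised by counting edges\<close>

lemma simple_graph_complete_graph: "simple_graph (complete_graph k)"
  by (simp add: simple_graph_def complete_graph_def)

lemma simple_graph_complete_minus_edge: "simple_graph (complete_minus_edge k)"
  by (auto simp: simple_graph_def complete_minus_edge_def delete_edge_def complete_graph_def)

lemma edges_complement_complete_graph: "edges (complement (complete_graph k)) = {}"
  by (simp add: complement_def complete_graph_def)

lemma edges_complement_complete_minus_edge: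
  "k \<ge> 2 \<Longrightarrow> edges (complement (complete_minus_edge k)) = {{0, 1}}"
  by (auto simp: complement_def complete_minus_edge_def delete_edge_def complete_graph_def)

text \<open>The two complements have 0 and 1 edges, and with so few edges the counts fix the
  isomorphism class; the witness for \<open>k\<close> is the number of vertices of G.\<close>

lemma card_edges_le_1_iff:
  assumes "simple_graph G" "card (verts G) \<ge> 2"
  shows "card (edges G) \<le> 1 \<longleftrightarrow> (\<exists>k\<ge>2. G \<simeq>\<^sub>g complement (complete_graph k) \<or>
    G \<simeq>\<^sub>g complement (complete_minus_edge k))"
proof
  assume le: "card (edges G) \<le> 1"
  let ?k = "card (verts G)"
  have v: "card (verts (complement (complete_graph ?k))) = ?k"
    "card (verts (complement (complete_minus_edge ?k))) = ?k"
    by (simp_all add: complete_graph_def complete_minus_edge_def delete_edge_def)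
  consider "card (edges G) = 0" | "card (edges G) = 1"
    using le by linarith
  then have "G \<simeq>\<^sub>g complement (complete_graph ?k) \<or> G \<simeq>\<^sub>g complement (complete_minus_edge ?k)"
  proof cases
    case 1
    then have "G \<simeq>\<^sub>g complement (complete_graph ?k)"
      using assms v
      by (intro graph_iso_if_card_edges_le_1)
        (auto simp: simple_graph_complement simple_graph_complete_graph
          edges_complement_complete_graph)
    then show ?thesis ..
  next
    case 2
    then have "G \<simeq>\<^sub>g complement (complete_minus_edge ?k)"
      using assms v
      by (intro graph_iso_if_card_edges_le_1)
        (auto simp: simple_graph_complement simple_graph_complete_minus_edge
          edges_complement_complete_minus_edge)
    then show ?thesis ..
  qed
  then show "\<exists>k\<ge>2. G \<simeq>\<^sub>g complement (complete_graph k) \<or>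
    G \<simeq>\<^sub>g complement (complete_minus_edge k)"
    using assms by blast
next
  assume "\<exists>k\<ge>2. G \<simeq>\<^sub>g complement (complete_graph k) \<or>
    G \<simeq>\<^sub>g complement (complete_minus_edge k)"
  then obtain k where "k \<ge> 2" "G \<simeq>\<^sub>g complement (complete_graph k) \<or>
    G \<simeq>\<^sub>g complement (complete_minus_edge k)"
    by blast
  then show "card (edges G) \<le> 1"
    using graph_iso_card_edges[OF assms(1)] simple_graph_complement
      simple_graph_complete_graph simple_graph_complete_minus_edge
    by (metis card.empty edges_complement_complete_graph edges_complement_complete_minus_edge
        is_singletonI is_singleton_altdef le_numeral_extra(4) zero_le)
qed

lemma graph_iso_complement_iff:
  assumes "simple_graph G" "simple_graph H"
  shows "complement G \<simeq>\<^sub>g complement H \<longleftrightarrow> G \<simeq>\<^sub>g H"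
  using assms graph_iso_complement complement_complement by metis

lemma card_edges_complement_le_1_iff:
  assumes "simple_graph G" "card (verts G) \<ge> 2"
  shows "card (edges (complement G)) \<le> 1 \<longleftrightarrow> (\<exists>k\<ge>2. G \<simeq>\<^sub>g complete_graph k \<or>
    G \<simeq>\<^sub>g complete_minus_edge k)"
  using card_edges_le_1_iff[of "complement G"] assms
  by (simp add: simple_graph_complement graph_iso_complement_iff simple_graph_complete_graph
      simple_graph_complete_minus_edge)

section \<open>Complete graphs with few edges removed, plus isolated vertices\<close>

text \<open>The vertices in \<open>{p..<n}\<close> are isolated: they raise the number of vertices
  to n without changing the number of edges.\<close>

definition near_complete :: "nat \<Rightarrow> nat \<Rightarrow> nat set set \<Rightarrow> nat sgraph" where
  "near_complete n p T = \<lparr>verts = {..<n}, edges = [{..<p}]\<^bsup>2\<^esup> - T\<rparr>"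

lemma simple_graph_near_complete:
  assumes "p \<le> n" shows "simple_graph (near_complete n p T)"
proof -
  have "[{..<p}]\<^bsup>2\<^esup> \<subseteq> [{..<n}]\<^bsup>2\<^esup>"
    using assms by (intro nsets_mono) auto
  then show ?thesis
    by (auto simp: simple_graph_def near_complete_def)
qed

lemma edge_near_complete:
  "{u, v} \<in> edges (near_complete n p T) \<longleftrightarrow> u < p \<and> v < p \<and> u \<noteq> v \<and> {u, v} \<notin> T"
  by (auto simp: near_complete_def)

text \<open>Minimality of p keeps the excess M of \<open>p choose 2\<close> over m small. M < p
  leaves room in K_p for a star with M edges, and M + 2 \<le> p for M edges forming disjoint
  triangles and single edges.\<close>

lemma ex_choose_2_minus:
  fixes n m :: nat
  assumes "1 \<le> n" "m \<le> n choose 2"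
  obtains p M where "p \<le> n" "m = (p choose 2) - M" "M < p" "M = 0 \<or> M + 2 \<le> p"
proof -
  \<comment> \<open>The bound 1 \<le> p matters for m = 0: with p = 0 the claim M < p would
    fail.\<close>
  define p where "p = (LEAST p. 1 \<le> p \<and> m \<le> p choose 2)"
  have p: "1 \<le> p \<and> m \<le> p choose 2"
    unfolding p_def by (rule LeastI[of _ n]) (use assms in simp)
  have "p \<le> n"
    unfolding p_def by (rule Least_le) (use assms in simp)
  have "(p choose 2) - m = 0 \<or> ((p choose 2) - m) + 2 \<le> p"
  proof (cases "p = 1")
    case False
    then obtain q where q: "p = Suc q" "1 \<le> q"
      using p by (cases p) auto
    then have "\<not> m \<le> q choose 2"
      using not_less_Least[of q "\<lambda>p. 1 \<le> p \<and> m \<le> p choose 2"] by (simp add: p_def)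
    \<comment> \<open>Passing from q to p = q + 1 adds q pairs, while m exceeds
      \<open>q choose 2\<close>; hence M < q, that is M + 2 \<le> p.\<close>
    moreover have "p choose 2 = q + (q choose 2)"
      using q by (simp add: numeral_2_eq_2)
    ultimately show ?thesis
      using q by linarith
  qed (simp add: numeral_2_eq_2)
  then show thesis
    using that[of p "(p choose 2) - m"] \<open>p \<le> n\<close> p by auto
qed

text \<open>Reduces feasibility to choosing the removed set \<open>T\<close>. Of the bounds on M,
  the star construction uses M < p and the paw-free construction the other one.\<close>

lemma feasible_if_near_complete:
  assumes "\<And>n p M. p \<le> n \<Longrightarrow> M < p \<Longrightarrow> M = 0 \<or> M + 2 \<le> p \<Longrightarrow>
    \<exists>T \<subseteq> [{..<p}]\<^bsup>2\<^esup>. card T = M \<and> induced_free G (near_complete n p T)"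
  shows "feasible (induced_free_family G)"
  unfolding feasible_def
proof (intro allI impI, elim conjE)
  fix n m :: nat assume "1 \<le> n" "m \<le> n choose 2"
  then obtain p M where p: "p \<le> n" "m = (p choose 2) - M" "M < p" "M = 0 \<or> M + 2 \<le> p"
    by (rule ex_choose_2_minus)
  then obtain T where T: "T \<subseteq> [{..<p}]\<^bsup>2\<^esup>" "card T = M" "induced_free G (near_complete n p T)"
    using assms by blast
  have "finite T"
    using T(1) by (rule finite_subset) (simp add: finite_imp_finite_nsets)
  then have "card (edges (near_complete n p T)) = m"
    using T p by (simp add: near_complete_def card_Diff_subset card_nsets)
  moreover have "card (verts (near_complete n p T)) = n"
    by (simp add: near_complete_def)
  ultimately show "\<exists>H\<in>induced_free_family G. card (verts H) = n \<and> card (edges H) = m"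
    using T simple_graph_near_complete[OF p(1)] by (auto simp: induced_free_family_def)
qed

section \<open>Embeddings, and induced subgraphs of a complete graph minus a star\<close>

lemma not_induced_freeE:
  assumes "\<not> induced_free G H"
  obtains f where "inj_on f (verts G)"
    "\<And>u v. u \<in> verts G \<Longrightarrow> v \<in> verts G \<Longrightarrow> u \<noteq> v \<Longrightarrow> {u, v} \<in> edges G \<longleftrightarrow> {f u, f v} \<in> edges H"
proof -
  obtain S where "induced H S \<simeq>\<^sub>g G"
    using assms by (auto simp: induced_free_def)
  then have "G \<simeq>\<^sub>g induced H S"
    by (rule graph_iso_sym)
  then obtain f where f: "bij_betw f (verts G) S"
    and e: "\<forall>u\<in>verts G. \<forall>v\<in>verts G. {u, v} \<in> edges G \<longleftrightarrow> {f u, f v} \<in> edges H \<inter> [S]\<^bsup>2\<^esup>"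
    unfolding graph_iso_def induced_def by auto
  have "{u, v} \<in> edges G \<longleftrightarrow> {f u, f v} \<in> edges H"
    if "u \<in> verts G" "v \<in> verts G" "u \<noteq> v" for u v
    using e that bij_betwE[OF f] inj_on_eq_iff[OF bij_betw_imp_inj_on[OF f]]
    by (auto)
  then show thesis
    using that bij_betw_imp_inj_on[OF f] by blast
qed

text \<open>The shape of an induced subgraph of K_p minus a star plus isolated vertices:
  \<open>Q\<close> is the part inside K_p, \<open>w\<close> the centre and \<open>N\<close> the
  leaves of the star. A \<open>w\<close> outside G covers the subgraphs that miss the
  centre.\<close>

definition clique_plus_vertex :: "'a sgraph \<Rightarrow> bool" where
  "clique_plus_vertex G \<longleftrightarrow> (\<exists>Q N w. \<forall>u\<in>verts G. \<forall>v\<in>verts G. u \<noteq> v \<longrightarrow>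
     ({u, v} \<in> edges G \<longleftrightarrow> u \<in> Q \<and> v \<in> Q \<and> \<not> (u = w \<and> v \<in> N) \<and> \<not> (v = w \<and> u \<in> N)))"

text \<open>Otherwise removing stars would realise every pair, because a copy of G in K_p minus a
  star passes its shape back to G along the embedding.\<close>

lemma clique_plus_vertex_if_not_feasible:
  assumes "\<not> feasible (induced_free_family G)"
  shows "clique_plus_vertex G"
proof (rule ccontr)
  assume not: "\<not> clique_plus_vertex G"
  have "feasible (induced_free_family G)"
  proof (rule feasible_if_near_complete)
    fix n p M :: nat assume M: "M < p"
    \<comment> \<open>The star has centre 0 and leaves 1, ..., M, all of them vertices of K_p since
      M < p.\<close>
    define T :: "nat set set" where "T = (\<lambda>i. {0, i}) ` {1..M}"
    have "T \<subseteq> [{..<p}]\<^bsup>2\<^esup>"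
      using M by (auto simp: T_def)
    moreover have "inj_on (\<lambda>i. {0, i}) {1..M}"
      by (auto simp: inj_on_def doubleton_eq_iff)
    then have "card T = M"
      by (simp add: T_def card_image)
    moreover have "induced_free G (near_complete n p T)"
    proof (rule ccontr)
      assume "\<not> induced_free G (near_complete n p T)"
      then obtain f where inj: "inj_on f (verts G)"
        and e: "\<And>u v. u \<in> verts G \<Longrightarrow> v \<in> verts G \<Longrightarrow> u \<noteq> v \<Longrightarrow>
          {u, v} \<in> edges G \<longleftrightarrow> {f u, f v} \<in> edges (near_complete n p T)"
        by (rule not_induced_freeE) blast
      have T: "{x, y} \<in> T \<longleftrightarrow> x = 0 \<and> y \<in> {1..M} \<or> y = 0 \<and> x \<in> {1..M}" for x y
        by (auto simp: T_def doubleton_eq_iff)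
      \<comment> \<open>\<open>w\<close> is the preimage of the centre 0. If the copy of G misses 0,
        no removed pair is hit, so \<open>N\<close> is empty and \<open>w\<close> arbitrary.\<close>
      obtain w N where w: "\<And>u v. u \<in> verts G \<Longrightarrow> v \<in> verts G \<Longrightarrow>
          (f u = 0 \<and> f v \<in> {1..M} \<longleftrightarrow> u = w \<and> v \<in> N)"
      proof (cases "0 \<in> f ` verts G")
        case True
        then obtain w where "w \<in> verts G" "f w = 0" by force
        then show thesis
          using that[of w "{v. f v \<in> {1..M}}"] inj_on_eq_iff[OF inj] by force
      next
        case False
        then show thesis
          using that[of undefined "{}"] by force
      qed
      have "{u, v} \<in> edges G \<longleftrightarrow> u \<in> {x. f x < p} \<and> v \<in> {x. f x < p} \<and>
          \<not> (u = w \<and> v \<in> N) \<and> \<not> (v = w \<and> u \<in> N)"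
        if "u \<in> verts G" "v \<in> verts G" "u \<noteq> v" for u v
        using e[OF that] w[OF that(1,2)] w[OF that(2,1)] inj_on_eq_iff[OF inj that(1,2)] that(3)
        unfolding edge_near_complete T by auto
      then show False
        using not unfolding clique_plus_vertex_def by blast
    qed
    ultimately show "\<exists>T \<subseteq> [{..<p}]\<^bsup>2\<^esup>. card T = M \<and> induced_free G (near_complete n p T)"
      by blast
  qed
  then show False
    using assms by blast
qed

section \<open>Paws\<close>

text \<open>All six pairs are prescribed, so the paw is induced: w, x, z form the triangle and y
  hangs at w. On x, y, z non-adjacency fails to be transitive.\<close>

definition has_paw :: "'a sgraph \<Rightarrow> bool" where
  "has_paw G \<longleftrightarrow> (\<exists>x\<in>verts G. \<exists>y\<in>verts G. \<exists>z\<in>verts G. \<exists>w\<in>verts G. distinct [x, y, z, w] \<and>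
     {x, z} \<in> edges G \<and> {x, y} \<notin> edges G \<and> {y, z} \<notin> edges G \<and>
     {w, x} \<in> edges G \<and> {w, y} \<in> edges G \<and> {w, z} \<in> edges G)"

text \<open>Write \<open>M = 3 * q + r\<close> with \<open>r < 3\<close> and take \<open>q\<close> triangles and \<open>r\<close> single edges: this uses
  \<open>3 * q + 2 * r \<le> M + 2\<close> vertices.\<close>

lemma ex_cluster_edges:
  "\<exists>T \<subseteq> [{..<M + 2}]\<^bsup>2\<^esup>. card T = M \<and>
     (\<forall>x y z. {x, y} \<in> T \<and> {y, z} \<in> T \<and> x \<noteq> z \<longrightarrow> {x, z} \<in> T)"
proof (induction M rule: less_induct)
  case (less M)
  consider "M = 0" | "M = 1" | "M = 2" | "M \<ge> 3"
    by linarith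
  then show ?case
  proof cases
    case 1
    then show ?thesis
      by (intro exI[of _ "{}"]) auto
  next
    case 2
    then show ?thesis
      by (intro exI[of _ "{{0, 1}}"]) (auto simp: doubleton_eq_iff)
  next
    case 3
    \<comment> \<open>The two edges are disjoint because a path with two edges is not transitive;
      they fill exactly the M + 2 = 4 vertices.\<close>
    then show ?thesis
      by (intro exI[of _ "{{0, 1}, {2, 3}}"])
        (auto simp: doubleton_eq_iff)
  next
    case 4
    \<comment> \<open>The induction hypothesis for M - 3 occupies the vertices below (M - 3) + 2 =
      a; the new triangle takes a, a + 1 and a + 2 = M + 1.\<close>
    define a where "a = M - 1"
    define D where "D = {{a, a + 1}, {a, a + 2}, {a + 1, a + 2}}"
    obtain T where T: "T \<subseteq> [{..<a}]\<^bsup>2\<^esup>" "card T = M - 3"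
      "\<And>x y z. {x, y} \<in> T \<Longrightarrow> {y, z} \<in> T \<Longrightarrow> x \<noteq> z \<Longrightarrow> {x, z} \<in> T"
    proof -
      have "M - 3 < M" "M - 3 + 2 = a"
        using 4 by (auto simp: a_def)
      then show thesis
        using less.IH[of "M - 3"] that by metis
    qed
    have lt: "x < a \<and> y < a" if "{x, y} \<in> T" for x y
      using T(1) that by (auto dest!: subsetD)
    have D: "{x, y} \<in> D \<longleftrightarrow> x \<noteq> y \<and> x \<in> {a, a + 1, a + 2} \<and> y \<in> {a, a + 1, a + 2}" for x y
      by (auto simp: D_def doubleton_eq_iff)
    have "finite T"
      using T(1) by (rule finite_subset) (simp add: finite_imp_finite_nsets)
    moreover have "card D = 3"
      by (simp add: D_def doubleton_eq_iff)
    moreover have "T \<inter> D = {}"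
      using lt by (fastforce simp: D_def)
    moreover have "finite D"
      by (simp add: D_def)
    ultimately have "card (T \<union> D) = M"
      using T(2) 4 by (simp add: card_Un_disjoint)
    moreover have "T \<union> D \<subseteq> [{..<M + 2}]\<^bsup>2\<^esup>"
    proof -
      have "[{..<a}]\<^bsup>2\<^esup> \<subseteq> [{..<M + 2}]\<^bsup>2\<^esup>"
        using 4 by (intro nsets_mono) (auto simp: a_def)
      moreover have "D \<subseteq> [{..<M + 2}]\<^bsup>2\<^esup>"
        using 4 by (auto simp: D_def a_def)
      ultimately show ?thesis
        using T(1) by blast
    qed
    \<comment> \<open>\<open>T\<close> lives below a and \<open>D\<close> from a on, so two pairs
      sharing y come from the same part.\<close>
    moreover have "{x, z} \<in> T \<union> D" if "{x, y} \<in> T \<union> D" "{y, z} \<in> T \<union> D" "x \<noteq> z" for x y z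
      using that T(3)[of x y z] lt[of x y] lt[of y z] by (auto simp: D)
    ultimately show ?thesis
      by blast
  qed
qed

lemma feasible_if_has_paw:
  assumes "has_paw G" shows "feasible (induced_free_family G)"
proof (rule feasible_if_near_complete)
  fix n p M :: nat assume M: "M = 0 \<or> M + 2 \<le> p"
  obtain T where T: "T \<subseteq> [{..<p}]\<^bsup>2\<^esup>" "card T = M"
    "\<And>x y z. {x, y} \<in> T \<Longrightarrow> {y, z} \<in> T \<Longrightarrow> x \<noteq> z \<Longrightarrow> {x, z} \<in> T"
  \<comment> \<open>For M = 0 there may be fewer than M + 2 vertices in K_p, so the empty set is
    taken directly.\<close>
  proof (cases "M = 0")
    case True
    then show thesis
      using that[of "{}"] by simp
  next
    case False
    obtain T where T: "T \<subseteq> [{..<M + 2}]\<^bsup>2\<^esup>" "card T = M"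
      "\<And>x y z. {x, y} \<in> T \<Longrightarrow> {y, z} \<in> T \<Longrightarrow> x \<noteq> z \<Longrightarrow> {x, z} \<in> T"
      using ex_cluster_edges[of M] by metis
    have "[{..<M + 2}]\<^bsup>2\<^esup> \<subseteq> [{..<p}]\<^bsup>2\<^esup>"
      using False M by (intro nsets_mono) auto
    then show thesis
      using that[of T] T by blast
  qed
  have "induced_free G (near_complete n p T)"
  proof (rule ccontr)
    assume "\<not> induced_free G (near_complete n p T)"
    then obtain f where inj: "inj_on f (verts G)"
      and e: "\<And>u v. u \<in> verts G \<Longrightarrow> v \<in> verts G \<Longrightarrow> u \<noteq> v \<Longrightarrow>
        {u, v} \<in> edges G \<longleftrightarrow> {f u, f v} \<in> edges (near_complete n p T)"
      by (rule not_induced_freeE) blast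
    obtain x y z w where v: "x \<in> verts G" "y \<in> verts G" "z \<in> verts G" "w \<in> verts G"
      and d: "x \<noteq> y" "x \<noteq> z" "x \<noteq> w" "y \<noteq> z" "y \<noteq> w" "z \<noteq> w"
      and paw: "{x, z} \<in> edges G" "{x, y} \<notin> edges G" "{y, z} \<notin> edges G"
        "{w, x} \<in> edges G" "{w, y} \<in> edges G" "{w, z} \<in> edges G"
      using assms unfolding has_paw_def by auto
    have "f x \<noteq> f y" "f y \<noteq> f z" "f x \<noteq> f z"
      using v d inj_on_eq_iff[OF inj] by auto
    \<comment> \<open>The edges to w rule out isolated images, so each missing edge among x, y, z
      must come from \<open>T\<close>, contradicting its transitivity.\<close>
    moreover have "f x < p" "f y < p" "f z < p"
      using paw e v d by (auto simp: edge_near_complete)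
    ultimately have "{f x, f y} \<in> T" "{f y, f z} \<in> T" "{f x, f z} \<notin> T"
      using paw e v d by (auto simp: edge_near_complete)
    then show False
      using T(3) \<open>f x \<noteq> f z\<close> by blast
  qed
  then show "\<exists>T \<subseteq> [{..<p}]\<^bsup>2\<^esup>. card T = M \<and> induced_free G (near_complete n p T)"
    using T by blast
qed

text \<open>In the complement z is adjacent to all other vertices, which forces them into
  \<open>Q\<close>. Hence every edge of G contains w, so G is a star plus isolated vertices, and two
  of its edges together with z yield the paw.\<close>

lemma has_paw_complement_if_isolated:
  assumes "simple_graph G" "card (edges G) \<ge> 2"
    and "clique_plus_vertex (complement G)"
    and z: "z \<in> verts G" "\<And>u. u \<in> verts G \<Longrightarrow> {u, z} \<notin> edges G"
  shows "has_paw (complement G)"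
proof -
  obtain Q N w where c: "\<And>u v. u \<in> verts G \<Longrightarrow> v \<in> verts G \<Longrightarrow> u \<noteq> v \<Longrightarrow>
      ({u, v} \<notin> edges G \<longleftrightarrow> u \<in> Q \<and> v \<in> Q \<and> \<not> (u = w \<and> v \<in> N) \<and> \<not> (v = w \<and> u \<in> N))"
    using assms(3) unfolding clique_plus_vertex_def
    by (auto simp: complement_def)
  have Q: "u \<in> Q" if "u \<in> verts G" "u \<noteq> z" for u
    using c[OF that(1) z(1) that(2)] z(2) that by blast
  \<comment> \<open>Neither end of an edge is z, so both lie in \<open>Q\<close>, and only the
    exception at \<open>w\<close> can make them non-adjacent in the complement.\<close>
  have edge: "u = w \<or> v = w" if "{u, v} \<in> edges G" "u \<in> verts G" "v \<in> verts G" "u \<noteq> v" for u v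
    using that c[of u v] Q z by (metis insert_commute)
  obtain d d' where d: "d \<in> edges G" "d' \<in> edges G" "d \<noteq> d'"
    using assms(2) by (meson card_2_iff' obtain_subset_with_card_n subsetD)
  have star: "\<exists>x. c = {w, x} \<and> w \<in> verts G \<and> x \<in> verts G \<and> x \<noteq> w" if c: "c \<in> edges G" for c
  proof -
    obtain u v where uv: "c = {u, v}" "u \<in> verts G" "v \<in> verts G" "u \<noteq> v"
      using simple_graph_edgeE[OF assms(1) c] .
    then have "u = w \<or> v = w"
      using edge c by blast
    then show ?thesis
      using uv by (auto simp: insert_commute)
  qed
  obtain x y where xy: "{w, x} \<in> edges G" "{w, y} \<in> edges G" "x \<noteq> y" "w \<in> verts G"
    "x \<in> verts G" "y \<in> verts G" "x \<noteq> w" "y \<noteq> w"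
    using star[OF d(1)] star[OF d(2)] d by blast
  then have "x \<noteq> z" "y \<noteq> z" "w \<noteq> z" "{x, y} \<notin> edges G"
    using z(2) edge by (auto simp: insert_commute)
  \<comment> \<open>In the complement x, y, z form a triangle and w is pendant at z.\<close>
  then show ?thesis
    using xy z unfolding has_paw_def complement_def
    by (intro bexI[of _ x] bexI[of _ w] bexI[of _ y] bexI[of _ z])
      (auto simp: insert_commute)
qed

text \<open>Without paws, the isolated-vertex lemma for G and for its complement excludes isolated
  and dominating vertices. Then all vertices lie in both cliques \<open>Q\<close> and
  \<open>Q'\<close>, and two vertices other than the centres w and w' would be both adjacent and
  non-adjacent.\<close>

lemma has_paw_if_clique_plus_vertex:
  assumes "simple_graph G" "card (verts G) \<ge> 4"
    and "card (edges G) \<ge> 2" "card (edges (complement G)) \<ge> 2"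
    and "clique_plus_vertex G" "clique_plus_vertex (complement G)"
  shows "has_paw G \<or> has_paw (complement G)"
proof (rule ccontr)
  assume no: "\<not> ?thesis"
  have iso: "\<exists>u\<in>verts G. {u, z} \<in> edges G" if "z \<in> verts G" for z
    using has_paw_complement_if_isolated[OF assms(1,3,6) that] no by blast
  \<comment> \<open>An isolated vertex of the complement is a dominating vertex of G; the resulting
    paw lies in the double complement, which is G.\<close>
  have dom: "\<exists>u\<in>verts G. u \<noteq> z \<and> {u, z} \<notin> edges G" if "z \<in> verts G" for z
    using has_paw_complement_if_isolated[of "complement G" z] no that assms
    by (auto simp: simple_graph_complement complement_complement)
      (auto simp: complement_def)
  obtain Q N w where c: "\<And>u v. u \<in> verts G \<Longrightarrow> v \<in> verts G \<Longrightarrow> u \<noteq> v \<Longrightarrow>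
      ({u, v} \<in> edges G \<longleftrightarrow> u \<in> Q \<and> v \<in> Q \<and> \<not> (u = w \<and> v \<in> N) \<and> \<not> (v = w \<and> u \<in> N))"
    using assms(5) unfolding clique_plus_vertex_def by auto
  obtain Q' N' w' where c': "\<And>u v. u \<in> verts G \<Longrightarrow> v \<in> verts G \<Longrightarrow> u \<noteq> v \<Longrightarrow>
      ({u, v} \<notin> edges G \<longleftrightarrow> u \<in> Q' \<and> v \<in> Q' \<and> \<not> (u = w' \<and> v \<in> N') \<and> \<not> (v = w' \<and> u \<in> N'))"
    using assms(6) unfolding clique_plus_vertex_def
    by (auto simp: complement_def)
  have loop: "{z} \<notin> edges G" for z
    using assms(1) by (auto simp: simple_graph_def nsets_def)
  have Q: "z \<in> Q" if "z \<in> verts G" for z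
    using iso[OF that] c that loop by (metis insert_absorb2)
  have Q': "z \<in> Q'" if "z \<in> verts G" for z
    using dom[OF that] c' that by metis
  \<comment> \<open>Here the four vertices are needed: at least two remain after deleting both
    centres.\<close>
  have "\<not> card (verts G - {w, w'}) \<le> 1"
    using assms(1,2) diff_card_le_card_Diff[of "{w, w'}" "verts G"] card_insert_le_m1[of 2 "{w'}" w]
    by (auto simp: simple_graph_def card_insert_if split: if_splits)
  then obtain u v where "u \<in> verts G - {w, w'}" "v \<in> verts G - {w, w'}" "u \<noteq> v"
    using assms(1) by (metis One_nat_def card_le_Suc0_iff_eq finite_Diff simple_graph_def)
  then show False
    using c[of u v] c'[of u v] Q Q' by auto
qed

section \<open>Feasibility in terms of the numbers of edges and non-edges\<close>

lemma feasible_iff: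
  assumes "simple_graph G" "card (verts G) \<ge> 2"
  shows "feasible (induced_free_family G) \<longleftrightarrow>
    card (edges G) \<ge> 2 \<and> card (edges (complement G)) \<ge> 2"
proof -
  have co: "feasible (induced_free_family (complement G)) \<longleftrightarrow> feasible (induced_free_family G)"
    using assms(1) feasible_complementD complement_complement simple_graph_complement by metis
  show ?thesis
  proof
    assume "feasible (induced_free_family G)"
    then show "card (edges G) \<ge> 2 \<and> card (edges (complement G)) \<ge> 2"
      using not_feasible_if_card_edges_le_1[of G] not_feasible_if_card_edges_le_1[of "complement G"]
        co assms by (force simp: simple_graph_complement not_less_eq_eq numeral_2_eq_2)
  next
    assume e: "card (edges G) \<ge> 2 \<and> card (edges (complement G)) \<ge> 2"
    \<comment> \<open>Two edges and two non-edges make at least four pairs, whereas three vertices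
      have only three.\<close>
    then have "card (verts G) choose 2 \<ge> 4"
      using card_edges_complement[OF assms(1)] by linarith
    moreover have "card (verts G) choose 2 \<le> 3" if "card (verts G) \<le> 3"
      using binomial_right_mono[OF that, of 2] by (simp add: numeral_eq_Suc)
    ultimately have "card (verts G) \<ge> 4"
      by linarith
    \<comment> \<open>If the family of G were not feasible, neither would be that of the complement.
      Both graphs would then be a clique plus a vertex, so one of them has a paw and its family is
      feasible after all.\<close>
    then show "feasible (induced_free_family G)"
      using e assms(1) co clique_plus_vertex_if_not_feasible has_paw_if_clique_plus_vertex
        feasible_if_has_paw by blast
  qed
qed

theorem mainTheorem1:
  fixes G :: "'a sgraph"
  assumes "simple_graph G" and "card (verts G) \<ge> 2"
  shows "feasible (induced_free_family G) \<longleftrightarrow>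
    \<not> (\<exists>k\<ge>2. G \<simeq>\<^sub>g complete_graph k \<or> G \<simeq>\<^sub>g complete_minus_edge k \<or>
        G \<simeq>\<^sub>g complement (complete_graph k) \<or> G \<simeq>\<^sub>g complement (complete_minus_edge k))"
proof -
  have "feasible (induced_free_family G) \<longleftrightarrow>
    \<not> (card (edges G) \<le> 1 \<or> card (edges (complement G)) \<le> 1)"
    using feasible_iff[OF assms] by linarith
  then show ?thesis
    unfolding card_edges_le_1_iff[OF assms] card_edges_complement_le_1_iff[OF assms] by blast
qed

end
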